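(* Let $x=(x^1,x^2)\in\mathbb{R}\times\Pi$, $\xi\in\mathbb{R}$ and $\beta>0$. The functions $h\in\mathcal{P}_2$ such that $x$ is a $B$-point for $h$, $h(x)=\xi$ and $\nabla h(x)=\begin{pmatrix}\beta\\0\end{pmatrix}$ are precisely the functions of the form $$h(z)=\xi+\frac{1}{\dfrac{1}{\beta(z^1-x^1)}-g(z)},\qquad z\in\Pi^2,$$ for some function $g\in\mathcal{P}_2$ such that $$\lim_{y\to0+}y\,g(x^1+\mathrm{i}y,x^2)=0.$$
   Context: $\Pi=\{z\in\mathbb{C}:\mathrm{Im}\,z>0\}$. Superscripts on points of $\mathbb{C}^2$ are coordinate indices: $z=(z^1,z^2)$, and $\|z\|=\max\{|z^1|,|z^2|\}$. The two-variable Pick class $\mathcal{P}_2$ is the set of analytic functions on $\Pi^2$ with non-negative imaginary part. A set $S\subset\Pi^2$ approaches $x\in\partial(\Pi^2)$ nontangentially if $x$ lies in the closure of $S$ and $\|z-x\|/\mathrm{dist}(z,\mathbb{C}^2\setminus\Pi^2)$ is bounded for $z\in S$. A nontangential limit at $x$ is a limit that exists, with the same value, along every set approaching $x$ nontangentially. A point $x\in\partial(\Pi^2)\subset\mathbb{C}^2$ is a $B$-point for $h\in\mathcal{P}_2$ if $\liminf_{z\to x}\frac{\mathrm{Im}\,h(z)}{\mathrm{Im}\,z^j}<\infty$ for $j=1,2$ ($z$ ranging over $\Pi^2$). The value $h(x)$ at a $B$-point $x$ denotes the nontangential limit of $h$ at $x$. A point $x\in\partial(\Pi^2)$ is a $C$-point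 for $h$ if for every set $S\subset\Pi^2$ approaching $x$ nontangentially there are $\xi\in\mathbb{R}$ and $\eta^1,\eta^2\in\mathbb{C}$ such that $h(z)=\xi+\eta^1(z^1-x^1)+\eta^2(z^2-x^2)+o(\|z-x\|)$ as $z\to x$ in $S$. These quantities are then the same for every such $S$, and the angular gradient is $\nabla h(x)=\begin{pmatrix}\eta^1\\\eta^2\end{pmatrix}$. (Every $B$-point of $h$ in $\mathbb{R}\times\Pi$ is a $C$-point of $h$, so $\nabla h(x)$ is defined there.) *)

theory Defs
  imports "HOL-Complex_Analysis.Complex_Analysis" "HOL-Library.Landau_Symbols"
begin

definition uhp :: "complex set" where
  "uhp = {z. Im z > 0}"

abbreviation uhp2 :: "(complex \<times> complex) set" where
  "uhp2 \<equiv> uhp \<times> uhp"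

text \<open>The instance norm on pairs is Euclidean; the maximum norm is used instead for
  everything metric. Both induce the same topology, so \<^term>\<open>closure\<close>, \<^term>\<open>frontier\<close>
  and the filters \<^term>\<open>at x within S\<close> are those of the library.\<close>

definition maxnorm :: "complex \<times> complex \<Rightarrow> real" where
  "maxnorm z = max (norm (fst z)) (norm (snd z))"

definition dist_compl :: "complex \<times> complex \<Rightarrow> real" where
  "dist_compl z = (INF w\<in>- uhp2. maxnorm (z - w))"

text \<open>Analyticity in two variables on an open set: a complex-linear Frechet derivative exists
  at every point.\<close>

definition holomorphic2_on :: "(complex \<times> complex \<Rightarrow> complex) \<Rightarrow> (complex \<times> complex) set \<Rightarrow> bool"
  (infixl "(holomorphic2'_on)" 50) where
  "h holomorphic2_on U \<longleftrightarrow>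
     (\<forall>z\<in>U. \<exists>a b. (h has_derivative (\<lambda>v. a * fst v + b * snd v)) (at z))"

text \<open>Functions are total in HOL; every notion below depends only on the values on
  \<^term>\<open>uhp2\<close>.\<close>

definition Pick2 :: "(complex \<times> complex \<Rightarrow> complex) set" where
  "Pick2 = {h. h holomorphic2_on uhp2 \<and> (\<forall>z\<in>uhp2. Im (h z) \<ge> 0)}"

definition nt_approach :: "(complex \<times> complex) set \<Rightarrow> complex \<times> complex \<Rightarrow> bool" where
  "nt_approach S x \<longleftrightarrow> S \<subseteq> uhp2 \<and> x \<in> frontier uhp2 \<and> x \<in> closure S \<and>
     (\<exists>c. \<forall>z\<in>S. maxnorm (z - x) / dist_compl z \<le> c)"

definition has_nt_limit ::
  "(complex \<times> complex \<Rightarrow> complex) \<Rightarrow> complex \<times> complex \<Rightarrow> complex \<Rightarrow> bool" where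
  "has_nt_limit h x l \<longleftrightarrow> (\<forall>S. nt_approach S x \<longrightarrow> (h \<longlongrightarrow> l) (at x within S))"

definition B_point :: "(complex \<times> complex \<Rightarrow> complex) \<Rightarrow> complex \<times> complex \<Rightarrow> bool" where
  "B_point h x \<longleftrightarrow> x \<in> frontier uhp2 \<and>
     Liminf (at x within uhp2) (\<lambda>z. ereal (Im (h z) / Im (fst z))) < \<infinity> \<and>
     Liminf (at x within uhp2) (\<lambda>z. ereal (Im (h z) / Im (snd z))) < \<infinity>"

definition first_order_expansion ::
  "(complex \<times> complex \<Rightarrow> complex) \<Rightarrow> complex \<times> complex \<Rightarrow> (complex \<times> complex) set
     \<Rightarrow> real \<Rightarrow> complex \<times> complex \<Rightarrow> bool" where
  "first_order_expansion h x S \<xi> \<eta> \<longleftrightarrow>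
     (\<lambda>z. h z - (of_real \<xi> + fst \<eta> * (fst z - fst x) + snd \<eta> * (snd z - snd x)))
       \<in> o[at x within S](\<lambda>z. of_real (maxnorm (z - x)))"

definition C_point :: "(complex \<times> complex \<Rightarrow> complex) \<Rightarrow> complex \<times> complex \<Rightarrow> bool" where
  "C_point h x \<longleftrightarrow> x \<in> frontier uhp2 \<and>
     (\<forall>S. nt_approach S x \<longrightarrow> (\<exists>\<xi> \<eta>. first_order_expansion h x S \<xi> \<eta>))"

text \<open>On a thin set \<open>S\<close> (a sequence on a line, say) the coefficients of the expansion are not
  unique; the angular gradient consists of the coefficients that serve all \<open>S\<close> at once.\<close>

definition has_angular_gradient ::
  "(complex \<times> complex \<Rightarrow> complex) \<Rightarrow> complex \<times> complex \<Rightarrow> complex \<times> complex \<Rightarrow> bool" where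
  "has_angular_gradient h x \<eta> \<longleftrightarrow> C_point h x \<and>
     (\<exists>\<xi>. \<forall>S. nt_approach S x \<longrightarrow> first_order_expansion h x S \<xi> \<eta>)"

end

theory Submission
  imports Defs
begin

text \<open>
  Write \<open>x = (a, b)\<close> and \<open>w = z\<^sup>1 - a\<close>. The map \<open>h \<mapsto> g = 1/(\<beta>w) - 1/(h - \<xi>)\<close> inverts the formula for
  \<open>h\<close>, so everything is about translating the conditions on \<open>h\<close> into conditions on \<open>g\<close>. Both
  translations rest on one fact, the Schwarz-Pick inequality on the product of two half-planes
  (\<open>Schwarz_Pick2\<close>): a Pick function does not increase the distance that is the larger of the two
  pseudohyperbolic distances between coordinates.

  From \<open>g\<close> to \<open>h\<close>: since \<open>-1/(\<beta>w)\<close> has positive imaginary part, so has \<open>g - 1/(\<beta>w)\<close>, and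
  \<open>h = \<xi> - 1/(g - 1/(\<beta>w))\<close> is a Pick function. Moreover \<open>h - \<xi> = \<beta>w/(1 - \<beta>wg)\<close>, so \<open>h\<close> has the
  first-order expansion \<open>\<xi> + \<beta>w\<close> on a set \<open>S\<close> as soon as \<open>wg \<rightarrow> 0\<close> on \<open>S\<close>. The hypothesis gives
  this only on the vertical segment above \<open>x\<close>. A point \<open>z\<close> near \<open>x\<close> in a nontangential set lies at a
  bounded distance from the point of that segment with the same height \<open>Im z\<^sup>1\<close>, and the
  Harnack inequality \<open>Harnack2\<close> that follows from Schwarz-Pick then bounds \<open>|g(z)|\<close> by a constant
  times the value of \<open>|g|\<close> there (\<open>nt_tendsto_of_vertical\<close>).

  From \<open>h\<close> to \<open>g\<close>: what has to be shown is \<open>Im g \<ge> 0\<close>, that is, the inequality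
  \<open>Im(-1/(h - \<xi>)) \<ge> Im(-1/(\<beta>w))\<close> on the whole product and not just on the slice \<open>z\<^sup>2 = b\<close>. It is
  obtained by applying Schwarz-Pick to \<open>z\<close> and \<open>(a + iy, b)\<close> and letting \<open>y\<close> tend to 0 (\<open>Julia2\<close>).
  The distance between the first coordinates tends to 1, the boundary value, while that between
  the second coordinates stays fixed below 1. So the first coordinate alone determines the
  larger distance, and \<open>z\<^sup>2\<close> disappears from the estimate. The expansion
  \<open>h(a + iy, b) = \<xi> + i\<beta>y + o(y)\<close> supplies the limit of the estimate, and also \<open>y g(a + iy, b) \<rightarrow> 0\<close>.
\<close>

section \<open>Two-variable holomorphic functions\<close>

lemma open_uhp: "open uhp"
  unfolding uhp_def by (rule open_halfspace_Im_gt)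

lemma open_uhp2: "open uhp2"
  by (intro open_Times open_uhp)

text \<open>Openness of the domain makes the derivative at a point of it insensitive to the values
  outside.\<close>

lemma holomorphic2_on_cong:
  assumes "f holomorphic2_on uhp2" "\<And>z. z \<in> uhp2 \<Longrightarrow> h z = f z"
  shows "h holomorphic2_on uhp2"
  unfolding holomorphic2_on_def
proof
  fix z assume z: "z \<in> uhp2"
  then obtain a b where "(f has_derivative (\<lambda>v. a * fst v + b * snd v)) (at z)"
    using assms(1) unfolding holomorphic2_on_def by blast
  then have "(h has_derivative (\<lambda>v. a * fst v + b * snd v)) (at z)"
    by (rule has_derivative_transform_within_open[OF _ open_uhp2 z]) (use assms(2) in auto)
  then show "\<exists>a b. (h has_derivative (\<lambda>v. a * fst v + b * snd v)) (at z)" by blast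
qed

lemma holomorphic2_on_add:
  assumes "f holomorphic2_on U" "g holomorphic2_on U"
  shows "(\<lambda>z. f z + g z) holomorphic2_on U"
  unfolding holomorphic2_on_def
proof
  fix z assume z: "z \<in> U"
  obtain a b where f: "(f has_derivative (\<lambda>v. a * fst v + b * snd v)) (at z)"
    using assms(1) z unfolding holomorphic2_on_def by blast
  obtain c d where g: "(g has_derivative (\<lambda>v. c * fst v + d * snd v)) (at z)"
    using assms(2) z unfolding holomorphic2_on_def by blast
  have "((\<lambda>z. f z + g z) has_derivative (\<lambda>v. (a+c) * fst v + (b+d) * snd v)) (at z)"
    by (rule has_derivative_eq_rhs[OF has_derivative_add[OF f g]]) (auto simp: algebra_simps)
  then show "\<exists>a b. ((\<lambda>z. f z + g z) has_derivative (\<lambda>v. a * fst v + b * snd v)) (at z)" by blast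
qed

lemma holomorphic2_on_compose:
  assumes f: "f holomorphic2_on U" and k: "\<And>z. z \<in> U \<Longrightarrow> \<exists>d. (k has_field_derivative d) (at (f z))"
  shows "(\<lambda>z. k (f z)) holomorphic2_on U"
  unfolding holomorphic2_on_def
proof
  fix z assume z: "z \<in> U"
  obtain a b where f: "(f has_derivative (\<lambda>v. a * fst v + b * snd v)) (at z)"
    using f z unfolding holomorphic2_on_def by blast
  obtain d where "(k has_field_derivative d) (at (f z))" using k z by blast
  then have "((\<lambda>z. k (f z)) has_derivative (\<lambda>v. d * (a * fst v + b * snd v))) (at z)"
    unfolding has_field_derivative_def using has_derivative_compose[OF f] by blast
  then have "((\<lambda>z. k (f z)) has_derivative (\<lambda>v. (d*a) * fst v + (d*b) * snd v)) (at z)"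
    by (simp add: algebra_simps)
  then show "\<exists>a b. ((\<lambda>z. k (f z)) has_derivative (\<lambda>v. a * fst v + b * snd v)) (at z)" by blast
qed

lemma holomorphic2_on_fst: "fst holomorphic2_on U"
  unfolding holomorphic2_on_def
proof
  fix z :: "complex \<times> complex"
  have "(fst has_derivative (\<lambda>v. 1 * fst v + 0 * snd v)) (at z)"
    by (auto intro!: derivative_eq_intros)
  then show "\<exists>a b. (fst has_derivative (\<lambda>v. a * fst v + b * snd v)) (at z)" by blast
qed

lemma holomorphic_on_compose_pair:
  assumes h: "h holomorphic2_on U" and p: "p holomorphic_on D" and q: "q holomorphic_on D"
    and D: "open D" and sub: "\<And>t. t \<in> D \<Longrightarrow> (p t, q t) \<in> U"
  shows "(\<lambda>t. h (p t, q t)) holomorphic_on D"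
proof (rule holomorphic_onI)
  fix t assume t: "t \<in> D"
  obtain a b where h: "(h has_derivative (\<lambda>v. a * fst v + b * snd v)) (at (p t, q t))"
    using h sub[OF t] unfolding holomorphic2_on_def by blast
  have p': "(p has_derivative (*) (deriv p t)) (at t)" and q': "(q has_derivative (*) (deriv q t)) (at t)"
    using holomorphic_derivI[OF p D t] holomorphic_derivI[OF q D t]
    by (auto simp: has_field_derivative_def)
  have "((\<lambda>t. h (p t, q t)) has_derivative (\<lambda>v. a * (deriv p t * v) + b * (deriv q t * v))) (at t)"
    using has_derivative_compose[OF has_derivative_Pair[OF p' q'] h] by simp
  moreover have "(\<lambda>v. a * (deriv p t * v) + b * (deriv q t * v)) = (*) (a * deriv p t + b * deriv q t)"
    by (auto simp: algebra_simps)
  ultimately have "((\<lambda>t. h (p t, q t)) has_field_derivative (a * deriv p t + b * deriv q t)) (at t)"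
    unfolding has_field_derivative_def by simp
  then show "(\<lambda>t. h (p t, q t)) field_differentiable at t within D"
    using field_differentiable_at_within field_differentiable_def by blast
qed

lemma Im_neg_inverse: "Im (- (1 / w)) = Im w / (norm w)\<^sup>2"
  by (simp add: Im_divide cmod_power2)

lemma Im_neg_inverse_linear:
  assumes "x \<in> \<real> \<times> uhp" "\<beta> > 0"
  shows "Im (- (1 / (of_real \<beta> * (z - fst x)))) = Im z / (\<beta> * (norm (z - fst x))\<^sup>2)"
  using assms unfolding Im_neg_inverse
  by (auto simp: complex_is_Real_iff norm_mult power_mult_distrib power2_eq_square)

lemma holomorphic2_on_neg_inverse_linear:
  assumes "x \<in> \<real> \<times> uhp" "\<beta> > 0"
  shows "(\<lambda>z. - (1 / (of_real \<beta> * (fst z - fst x)))) holomorphic2_on uhp2"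
proof (rule holomorphic2_on_compose[OF holomorphic2_on_fst])
  fix z assume "z \<in> uhp2"
  then have "fst z \<noteq> fst x" using assms by (auto simp: uhp_def complex_is_Real_iff)
  then have "((\<lambda>w. - (1 / (of_real \<beta> * (w - fst x)))) field_differentiable at (fst z))"
    using assms by (auto intro!: derivative_intros simp del: divide_minus_left)
  then show "\<exists>d. ((\<lambda>w. - (1 / (of_real \<beta> * (w - fst x)))) has_field_derivative d) (at (fst z))"
    by (simp add: field_differentiable_def)
qed

lemma has_field_derivative_inverse_shift:
  fixes s w k l :: complex
  assumes "w \<noteq> s"
  shows "\<exists>d. ((\<lambda>w. k + l / (w - s)) has_field_derivative d) (at w)"
proof -
  have "(\<lambda>w. k + l / (w - s)) field_differentiable at w"
    using assms by (auto intro!: derivative_intros)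
  then show ?thesis by (simp add: field_differentiable_def)
qed

section \<open>The Schwarz-Pick inequality\<close>

text \<open>The pseudohyperbolic distance of the upper half-plane, which is the modulus of the Cayley
  transform \<open>(z - p)/(z - cnj p)\<close> that sends \<open>p\<close> to the centre of the unit disc.\<close>

definition pseudo_dist :: "complex \<Rightarrow> complex \<Rightarrow> real" where
  "pseudo_dist z p = norm (z - p) / norm (z - cnj p)"

text \<open>The identity by which estimates of \<^const>\<open>pseudo_dist\<close> become estimates of imaginary
  parts.\<close>

lemma norm_diff_cnj_sq: "(norm (z - cnj p))\<^sup>2 = (norm (z - p))\<^sup>2 + 4 * Im z * Im p"
  unfolding cmod_power2 by (simp add: power2_eq_square algebra_simps)

lemma neq_cnj: "z \<in> uhp \<Longrightarrow> Im p \<ge> 0 \<Longrightarrow> z \<noteq> cnj p"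
  by (auto simp: uhp_def)

lemma pseudo_dist_less_1:
  assumes "z \<in> uhp" "p \<in> uhp"
  shows "pseudo_dist z p < 1"
proof -
  have "(norm (z - p))\<^sup>2 < (norm (z - cnj p))\<^sup>2"
    using assms by (simp add: norm_diff_cnj_sq uhp_def)
  then have "norm (z - p) < norm (z - cnj p)"
    by (rule power_less_imp_less_base) simp
  then show ?thesis unfolding pseudo_dist_def
    by (metis divide_less_eq_1 norm_ge_zero order_le_less_trans)
qed

text \<open>The inverse of the Cayley transform \<open>z \<mapsto> (z - p)/(z - cnj p)\<close>.\<close>

definition uncayley :: "complex \<Rightarrow> complex \<Rightarrow> complex" where
  "uncayley p c = (p - cnj p * c) / (1 - c)"

lemma uncayley_in_uhp:
  assumes "p \<in> uhp" "norm c < 1"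
  shows "uncayley p c \<in> uhp"
proof -
  have c: "c \<noteq> 1" using assms by auto
  have n0: "(norm (1 - c))\<^sup>2 > 0" using c by simp
  have c2: "(Re c)\<^sup>2 + (Im c)\<^sup>2 < 1"
    using assms(2) by (metis cmod_power2 norm_ge_zero power_less_one_iff zero_neq_numeral less_numeral_extra(1) zero_less_numeral)
  have "uncayley p c = (p - cnj p * c) * cnj (1 - c) / of_real ((norm (1 - c))\<^sup>2)"
    unfolding uncayley_def by (rule complex_div_cnj)
  then have "Im (uncayley p c) = Im ((p - cnj p * c) * cnj (1 - c)) / (norm (1 - c))\<^sup>2"
    by (metis Im_divide_of_real)
  also have "Im ((p - cnj p * c) * cnj (1 - c)) = Im p * (1 - ((Re c)\<^sup>2 + (Im c)\<^sup>2))"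
    by (simp add: algebra_simps power2_eq_square)
  finally show ?thesis using n0 c2 assms by (simp add: uhp_def)
qed

lemma uncayley_0: "uncayley p 0 = p"
  by (simp add: uncayley_def)

lemma uncayley_cayley:
  assumes "z \<in> uhp" "p \<in> uhp"
  shows "uncayley p ((z - p) / (z - cnj p)) = z"
proof -
  have ne: "z - cnj p \<noteq> 0" using neq_cnj assms by (auto simp: uhp_def)
  have pp: "p - cnj p \<noteq> 0" using assms by (auto simp: uhp_def complex_eq_iff)
  have "1 - (z - p) / (z - cnj p) = (p - cnj p) / (z - cnj p)"
    using ne by (simp add: field_simps)
  moreover have "p - cnj p * ((z - p) / (z - cnj p)) = z * (p - cnj p) / (z - cnj p)"
    using ne by (simp add: field_simps)
  ultimately show ?thesis unfolding uncayley_def using ne pp by simp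
qed

lemma uncayley_holomorphic:
  assumes "norm u \<le> 1"
  shows "(\<lambda>t. uncayley p (t * u)) holomorphic_on ball 0 1"
proof -
  have "1 - t * u \<noteq> 0" if "t \<in> ball 0 1" for t
  proof -
    have "norm (t * u) < 1" using that assms
      by (simp add: norm_mult) (metis mult.right_neutral mult_left_le norm_ge_zero order_le_less_trans)
    then show ?thesis by auto
  qed
  then show ?thesis unfolding uncayley_def by (intro holomorphic_intros) auto
qed

text \<open>Let \<open>c\<^sub>1, c\<^sub>2\<close> be the Cayley transforms of the coordinates of \<open>z\<close> centred at those of \<open>p\<close>,
  so that \<open>|c\<^sub>i| \<le> r\<close>. Then \<open>t \<mapsto> (tc\<^sub>1/r, tc\<^sub>2/r)\<close> is an analytic disc in the bidisc which passes
  through the images of \<open>p\<close> at \<open>t = 0\<close> and of \<open>z\<close> at \<open>t = r\<close>. The one-variable Schwarz lemma on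
  this disc gives the claim.\<close>

lemma Schwarz_Pick2:
  assumes h: "h \<in> Pick2" and z: "z \<in> uhp2" and p: "p \<in> uhp2"
    and r1: "pseudo_dist (fst z) (fst p) \<le> r" and r2: "pseudo_dist (snd z) (snd p) \<le> r"
    and r: "r < 1"
  shows "norm (h z - h p) \<le> r * norm (h z - cnj (h p))"
proof (cases "r = 0")
  case True
  have "norm (w - q) \<le> 0" if "w \<in> uhp" "q \<in> uhp" "pseudo_dist w q \<le> 0" for w q
    using that neq_cnj[of w q] unfolding pseudo_dist_def
    by (auto simp: divide_le_0_iff uhp_def)
  then have "fst z = fst p" "snd z = snd p" using True z p r1 r2 by auto
  then have "z = p" by (rule prod_eqI)
  then show ?thesis using True by simp
next
  case False
  have r0: "r > 0" using False r1 unfolding pseudo_dist_def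
    by (smt (verit) divide_nonneg_nonneg norm_ge_zero)
  define u1 where "u1 = (fst z - fst p) / (fst z - cnj (fst p)) / of_real r"
  define u2 where "u2 = (snd z - snd p) / (snd z - cnj (snd p)) / of_real r"
  have nu: "norm u1 \<le> 1" "norm u2 \<le> 1"
    using r0 r1 r2 unfolding u1_def u2_def pseudo_dist_def norm_divide
    by (simp_all add: divide_le_eq_1 del: divide_divide_eq_left)
  define P where "P t = uncayley (fst p) (t * u1)" for t
  define Q where "Q t = uncayley (snd p) (t * u2)" for t
  have lt: "norm (t * u) < 1" if "t \<in> ball 0 1" "norm u \<le> 1" for t u :: complex
    using that by (simp add: norm_mult)
      (metis mult.right_neutral mult_left_le norm_ge_zero order_le_less_trans)
  have PQ: "(P t, Q t) \<in> uhp2" if "t \<in> ball 0 1" for t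
    unfolding P_def Q_def using uncayley_in_uhp lt that nu p by auto
  have PQ0: "(P 0, Q 0) = p" by (simp add: P_def Q_def uncayley_0)
  have PQr: "(P (of_real r), Q (of_real r)) = z"
    using r0 z p by (auto simp: P_def Q_def u1_def u2_def uncayley_cayley prod_eq_iff)
  define k where "k t = h (P t, Q t)" for t
  have khol: "k holomorphic_on ball 0 1"
    unfolding k_def
    by (rule holomorphic_on_compose_pair[where U = uhp2])
      (use h nu PQ in \<open>auto simp: Pick2_def P_def Q_def uncayley_holomorphic\<close>)
  have kIm: "Im (k t) \<ge> 0" if "t \<in> ball 0 1" for t
    unfolding k_def using h PQ[OF that] by (auto simp: Pick2_def)
  \<comment> \<open>The imaginary part of \<open>h\<close> may vanish, whereas the Cayley transform needs values in the open
    half-plane; hence the shift by \<open>ie\<close>, removed at the end by \<open>e \<rightarrow> 0\<close>.\<close>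
  have eps: "norm (h z - h p) \<le> r * norm (h z - cnj (h p) + 2 * \<i> * of_real e)" if e: "e > 0" for e
  proof -
    define q where "q = k 0 + \<i> * of_real e"
    have q: "q \<in> uhp" using kIm[of 0] e by (simp add: q_def uhp_def)
    define F where "F t = (k t + \<i> * of_real e - q) / (k t + \<i> * of_real e - cnj q)" for t
    have ke: "k t + \<i> * of_real e \<in> uhp" if "t \<in> ball 0 1" for t
      using kIm[OF that] e by (simp add: uhp_def)
    have F1: "F holomorphic_on ball 0 1" unfolding F_def
      using neq_cnj ke q by (intro holomorphic_intros khol) (auto simp: uhp_def)
    have F2: "norm (F t) < 1" if "norm t < 1" for t
      using pseudo_dist_less_1[OF ke q, of t] that by (simp add: F_def pseudo_dist_def norm_divide)
    have F0: "F 0 = 0" by (simp add: F_def q_def)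
    have rb: "norm (of_real r :: complex) < 1" using r r0 by simp
    have "norm (F (of_real r)) \<le> norm (of_real r :: complex)"
      by (rule Schwarz_Lemma(1)[OF F1 F0 F2 rb])
    then have *: "norm (F (of_real r)) \<le> r" using r0 by simp
    have "k (of_real r) + \<i> * of_real e - cnj q \<noteq> 0"
      using neq_cnj[OF ke, of "of_real r" q] rb q by (auto simp: uhp_def)
    then have "norm (k (of_real r) + \<i> * of_real e - q) \<le> r * norm (k (of_real r) + \<i> * of_real e - cnj q)"
      using * unfolding F_def norm_divide by (simp add: divide_le_eq)
    moreover have "k 0 = h p" "k (of_real r) = h z" by (simp_all add: k_def PQ0 PQr)
    ultimately show ?thesis by (simp add: q_def algebra_simps)
  qed
  have "((\<lambda>e. r * norm (h z - cnj (h p) + 2 * \<i> * of_real e)) \<longlongrightarrow>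
          r * norm (h z - cnj (h p) + 2 * \<i> * of_real 0)) (at_right 0)"
    by (intro tendsto_intros)
  moreover have "\<forall>\<^sub>F e in at_right 0. norm (h z - h p) \<le> r * norm (h z - cnj (h p) + 2 * \<i> * of_real e)"
    using eps by (auto simp: eventually_at_right_less intro: eventually_mono[OF eventually_at_right_less])
  ultimately show ?thesis
    using tendsto_lowerbound[of _ _ "at_right (0::real)"] by fastforce
qed

text \<open>The triangle inequality applied to both sides of Schwarz-Pick. The bound is homogeneous in
  \<open>h\<close>, which is what carries a smallness condition from one point to another.\<close>

lemma Harnack2:
  assumes h: "h \<in> Pick2" and z: "z \<in> uhp2" and p: "p \<in> uhp2"
    and r1: "pseudo_dist (fst z) (fst p) \<le> r" and r2: "pseudo_dist (snd z) (snd p) \<le> r"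
    and r: "r < 1"
  shows "norm (h z) \<le> (1 + r) / (1 - r) * norm (h p)"
proof -
  have r0: "r \<ge> 0" using r1 unfolding pseudo_dist_def
    by (smt (verit) divide_nonneg_nonneg norm_ge_zero)
  have "norm (h z) - norm (h p) \<le> norm (h z - h p)" by (rule norm_triangle_ineq2)
  also have "\<dots> \<le> r * norm (h z - cnj (h p))" by (rule Schwarz_Pick2[OF assms])
  also have "\<dots> \<le> r * (norm (h z) + norm (h p))"
    using norm_triangle_ineq4[of "h z" "cnj (h p)"] r0 by (simp add: mult_left_mono)
  finally show ?thesis using r by (simp add: field_simps)
qed

section \<open>Nontangential approach\<close>

lemma bdd_below_maxnorm: "bdd_below ((\<lambda>w. maxnorm (z - w)) ` A)"
  by (rule bdd_belowI[of _ 0]) (auto simp: maxnorm_def le_max_iff_disj)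

lemma dist_compl_le_Im_fst:
  assumes "z \<in> uhp2"
  shows "dist_compl z \<le> Im (fst z)"
proof -
  have m: "maxnorm (z - (of_real (Re (fst z)), snd z)) = Im (fst z)"
    using assms by (auto simp: maxnorm_def uhp_def cmod_def)
  have "dist_compl z \<le> maxnorm (z - (of_real (Re (fst z)), snd z))"
    unfolding dist_compl_def
    by (rule cINF_lower[OF bdd_below_maxnorm]) (auto simp: uhp_def)
  then show ?thesis using m by simp
qed

lemma dist_compl_ge:
  shows "min (Im (fst z)) (Im (snd z)) \<le> dist_compl z"
  unfolding dist_compl_def
proof (rule cINF_greatest)
  show "- uhp2 \<noteq> {}" by (auto simp: uhp_def set_eq_iff intro!: exI[of _ 0])
  fix w assume "w \<in> - uhp2"
  then have "Im (fst w) \<le> 0 \<or> Im (snd w) \<le> 0" by (auto simp: uhp_def mem_Times_iff)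
  moreover have "Im (fst z) - Im (fst w) \<le> norm (fst z - fst w)"
      "Im (snd z) - Im (snd w) \<le> norm (snd z - snd w)"
    using abs_Im_le_cmod[of "fst z - fst w"] abs_Im_le_cmod[of "snd z - snd w"] by auto
  ultimately show "min (Im (fst z)) (Im (snd z)) \<le> maxnorm (z - w)"
    by (auto simp: maxnorm_def)
qed

lemma dist_compl_pos: "z \<in> uhp2 \<Longrightarrow> dist_compl z > 0"
  using dist_compl_ge[of z] by (auto simp: uhp_def mem_Times_iff)

text \<open>Near a point of \<open>\<real> \<times> \<Pi>\<close> the second coordinate stays away from the boundary, so nontangential
  approach to it takes the form of a cone condition on the first coordinate.\<close>

lemma nt_approach_bound:
  assumes "nt_approach S x"
  obtains c where "c > 0" "\<And>z. z \<in> S \<Longrightarrow> norm (fst z - fst x) \<le> c * Im (fst z)"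
proof -
  obtain c where c: "\<And>z. z \<in> S \<Longrightarrow> maxnorm (z - x) / dist_compl z \<le> c" and S: "S \<subseteq> uhp2"
    using assms unfolding nt_approach_def by blast
  have "norm (fst z - fst x) \<le> max c 1 * Im (fst z)" if "z \<in> S" for z
  proof -
    have d: "dist_compl z > 0" "dist_compl z \<le> Im (fst z)"
      using S that dist_compl_pos dist_compl_le_Im_fst by blast+
    have "norm (fst z - fst x) \<le> maxnorm (z - x)" by (simp add: maxnorm_def)
    also have "\<dots> \<le> c * dist_compl z" using c[OF that] d by (simp add: divide_le_eq)
    also have "\<dots> \<le> max c 1 * Im (fst z)" using d by (intro mult_mono) auto
    finally show ?thesis .
  qed
  then show ?thesis by (intro that[of "max c 1"]) auto
qed

abbreviation above :: "complex \<times> complex \<Rightarrow> real \<Rightarrow> complex \<times> complex" where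
  "above x y \<equiv> (fst x + \<i> * of_real y, snd x)"

definition vertical_segment :: "complex \<times> complex \<Rightarrow> (complex \<times> complex) set" where
  "vertical_segment x = above x ` {0<..<Im (snd x)}"

lemma above_in_uhp2: "x \<in> \<real> \<times> uhp \<Longrightarrow> y > 0 \<Longrightarrow> above x y \<in> uhp2"
  by (auto simp: uhp_def mem_Times_iff complex_is_Real_iff)

lemma filterlim_above:
  assumes "\<forall>\<^sub>F y in at_right 0. above x y \<in> S"
  shows "filterlim (above x) (at x within S) (at_right 0)"
  unfolding filterlim_at
proof
  have "((\<lambda>y. above x y) \<longlongrightarrow> (fst x + \<i> * of_real 0, snd x)) (at_right 0)"
    by (intro tendsto_intros)
  then show "(above x \<longlongrightarrow> x) (at_right 0)" by simp
  show "\<forall>\<^sub>F y in at_right 0. above x y \<in> S \<and> above x y \<noteq> x"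
    using assms eventually_at_right_less[of 0]
    by eventually_elim (auto simp: prod_eq_iff)
qed

lemma filterlim_above_uhp2:
  assumes "x \<in> \<real> \<times> uhp"
  shows "filterlim (above x) (at x within uhp2) (at_right 0)"
  by (rule filterlim_above) 
    (use above_in_uhp2[OF assms] in \<open>auto intro: eventually_mono[OF eventually_at_right_less]\<close>)

lemma filterlim_above_segment:
  assumes "x \<in> \<real> \<times> uhp"
  shows "filterlim (above x) (at x within vertical_segment x) (at_right 0)"
proof (rule filterlim_above)
  have "Im (snd x) > 0" using assms by (auto simp: uhp_def)
  then have "\<forall>\<^sub>F y in at_right 0. y \<in> {0<..<Im (snd x)}"
    by (rule eventually_at_right_real)
  then show "\<forall>\<^sub>F y in at_right 0. above x y \<in> vertical_segment x"
    by eventually_elim (auto simp: vertical_segment_def)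
qed

lemma closure_of_filterlim:
  assumes "filterlim f (at x within S) F" "F \<noteq> bot"
  shows "x \<in> closure S"
proof -
  have "at x within S \<noteq> bot" using assms
    by (metis filterlim_def filtermap_bot_iff le_bot)
  then show ?thesis
    by (metis at_within_eq_bot_iff closure_mono Diff_subset subsetD)
qed

lemma in_frontier:
  assumes "x \<in> \<real> \<times> uhp"
  shows "x \<in> frontier uhp2"
proof -
  have "x \<in> closure uhp2"
    using closure_of_filterlim[OF filterlim_above_uhp2[OF assms]] by simp
  moreover have "x \<notin> uhp2" using assms by (auto simp: uhp_def complex_is_Real_iff)
  ultimately show ?thesis by (simp add: frontier_def interior_open open_uhp2)
qed

lemma nt_approach_vertical_segment:
  assumes "x \<in> \<real> \<times> uhp"
  shows "nt_approach (vertical_segment x) x"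
  unfolding nt_approach_def
proof (intro conjI exI[of _ 1] ballI)
  show "vertical_segment x \<subseteq> uhp2"
    using above_in_uhp2[OF assms] by (auto simp: vertical_segment_def)
  show "x \<in> frontier uhp2" by (rule in_frontier[OF assms])
  show "x \<in> closure (vertical_segment x)"
    by (rule closure_of_filterlim[OF filterlim_above_segment[OF assms]]) simp
  fix z assume "z \<in> vertical_segment x"
  then obtain y where y: "0 < y" "y < Im (snd x)" "z = above x y"
    by (auto simp: vertical_segment_def)
  have "Im (fst x) = 0" using assms by (auto simp: complex_is_Real_iff)
  then have "y \<le> dist_compl z" using dist_compl_ge[of z] y by simp
  moreover have "maxnorm (z - x) = y" using y by (simp add: maxnorm_def norm_mult)
  ultimately show "maxnorm (z - x) / dist_compl z \<le> 1"
    using y by simp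
qed

section \<open>From the parameter to the function\<close>

text \<open>The point \<open>z\<close> is compared with the point of the vertical segment of equal height. The cone
  condition keeps the first coordinates at a pseudohyperbolic distance of at most
  \<open>c / sqrt (c\<^sup>2 + 4)\<close>, and the second coordinates are close because \<open>z \<rightarrow> x\<close>; so Harnack's
  inequality applies with a constant that does not depend on \<open>z\<close>.\<close>

lemma nt_tendsto_of_vertical:
  assumes x: "x \<in> \<real> \<times> uhp" and g: "g \<in> Pick2" and S: "nt_approach S x"
    and lim: "((\<lambda>y::real. of_real y * g (above x y)) \<longlongrightarrow> 0) (at_right 0)"
  shows "((\<lambda>z. (fst z - fst x) * g z) \<longlongrightarrow> 0) (at x within S)"
proof -
  obtain c where c: "c > 0" "\<And>z. z \<in> S \<Longrightarrow> norm (fst z - fst x) \<le> c * Im (fst z)"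
    using nt_approach_bound[OF S] by blast
  have SU: "S \<subseteq> uhp2" using S by (simp add: nt_approach_def)
  have x0: "Im (fst x) = 0" "snd x \<in> uhp" using x by (auto simp: complex_is_Real_iff)
  have inS: "\<forall>\<^sub>F z in at x within S. z \<in> S" by (simp add: eventually_at_filter)
  define r0 where "r0 = sqrt (c\<^sup>2 / (c\<^sup>2 + 4))"
  \<comment> \<open>\<open>r0\<close> bounds the distance of the first coordinates; any bound in \<open>(0, 1)\<close> serves the second.\<close>
  define r where "r = max r0 (1/2)"
  have cc: "c\<^sup>2 + 4 > 0" by (simp add: add_nonneg_pos)
  then have r: "r < 1" "r \<ge> 0" by (auto simp: r_def r0_def)
  define K where "K = c * ((1 + r) / (1 - r))"
  have d1: "pseudo_dist (fst z) (fst x + \<i> * of_real (Im (fst z))) \<le> r" if "z \<in> S" for z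
  proof -
    let ?p = "fst x + \<i> * of_real (Im (fst z))" let ?t = "Re (fst z) - Re (fst x)"
    have n1: "(norm (fst z - ?p))\<^sup>2 = ?t\<^sup>2" using x0 by (simp add: cmod_power2)
    have n2: "(norm (fst z - cnj ?p))\<^sup>2 = ?t\<^sup>2 + 4 * (Im (fst z))\<^sup>2"
      using x0 unfolding norm_diff_cnj_sq n1 by (simp add: power2_eq_square)
    have zp: "Im (fst z) > 0" using SU that by (auto simp: uhp_def)
    have "\<bar>?t\<bar> \<le> c * Im (fst z)" using c(2)[OF that] abs_Re_le_cmod[of "fst z - fst x"] by simp
    then have "\<bar>?t\<bar>\<^sup>2 \<le> (c * Im (fst z))\<^sup>2" by (intro power_mono) auto
    then have t2: "?t\<^sup>2 \<le> c\<^sup>2 * (Im (fst z))\<^sup>2" by (simp add: power_mult_distrib)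
    then have "?t\<^sup>2 / (?t\<^sup>2 + 4 * (Im (fst z))\<^sup>2) \<le> c\<^sup>2 / (c\<^sup>2 + 4)"
      using cc zp by (simp add: divide_le_eq le_divide_eq add_nonneg_pos) (simp add: algebra_simps)
    then have "(pseudo_dist (fst z) ?p)\<^sup>2 \<le> c\<^sup>2 / (c\<^sup>2 + 4)"
      unfolding pseudo_dist_def power_divide n1 n2 .
    then have "pseudo_dist (fst z) ?p \<le> r0" unfolding r0_def by (rule real_le_rsqrt)
    then show ?thesis by (simp add: r_def)
  qed
  have fl: "(fst \<longlongrightarrow> fst x) (at x within S)" "(snd \<longlongrightarrow> snd x) (at x within S)"
    by (auto intro!: tendsto_intros)
  have "((\<lambda>z. pseudo_dist (snd z) (snd x)) \<longlongrightarrow> pseudo_dist (snd x) (snd x)) (at x within S)"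
    unfolding pseudo_dist_def
    using neq_cnj[of "snd x" "snd x"] x0 by (intro tendsto_intros fl) (auto simp: uhp_def)
  then have d2: "\<forall>\<^sub>F z in at x within S. pseudo_dist (snd z) (snd x) < 1/2"
    by (rule order_tendstoD) (simp add: pseudo_dist_def)
  have bound: "\<forall>\<^sub>F z in at x within S. norm ((fst z - fst x) * g z)
      \<le> K * norm (of_real (Im (fst z)) * g (above x (Im (fst z))))"
    using d2 inS
  proof eventually_elim
    case (elim z)
    have zU: "z \<in> uhp2" and zp: "Im (fst z) > 0" using SU elim by (auto simp: uhp_def)
    have "norm (g z) \<le> (1 + r) / (1 - r) * norm (g (above x (Im (fst z))))"
      by (rule Harnack2[OF g zU above_in_uhp2[OF x zp]]) (use d1 elim r in \<open>auto simp: r_def\<close>)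
    then have "norm (fst z - fst x) * norm (g z)
      \<le> (c * Im (fst z)) * ((1 + r) / (1 - r) * norm (g (above x (Im (fst z)))))"
      using c elim zp by (intro mult_mono) auto
    then show ?case using zp unfolding norm_mult K_def by (simp add: ac_simps)
  qed
  \<comment> \<open>The heights tend to 0 from above, so the hypothesis on the segment can be composed with them.\<close>
  have "((\<lambda>z. Im (fst z)) \<longlongrightarrow> Im (fst x)) (at x within S)" by (intro tendsto_intros)
  moreover have "\<forall>\<^sub>F z in at x within S. Im (fst z) > 0"
    using inS by eventually_elim (use SU in \<open>auto simp: uhp_def\<close>)
  ultimately have "filterlim (\<lambda>z. Im (fst z)) (at_right 0) (at x within S)"
    unfolding x0 by (simp add: filterlim_at eventually_conj_iff) (auto elim: eventually_mono)
  from filterlim_compose[OF lim this]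
  have "((\<lambda>z. of_real (Im (fst z)) * g (above x (Im (fst z)))) \<longlongrightarrow> 0) (at x within S)" .
  then have "((\<lambda>z. K * norm (of_real (Im (fst z)) * g (above x (Im (fst z))))) \<longlongrightarrow> K * norm (0::complex)) (at x within S)"
    by (intro tendsto_intros)
  then have K0: "((\<lambda>z. K * norm (of_real (Im (fst z)) * g (above x (Im (fst z))))) \<longlongrightarrow> 0) (at x within S)"
    by simp
  show ?thesis
    by (rule Lim_null_comparison[OF bound K0])
qed

text \<open>To bound a lower limit it suffices to look along one path.\<close>

lemma Liminf_less_infinity:
  assumes "filterlim \<gamma> F G" "G \<noteq> bot" "\<forall>\<^sub>F y in G. f (\<gamma> y) \<le> (C::real)"
  shows "Liminf F (\<lambda>z. ereal (f z)) < \<infinity>"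
proof (rule ccontr)
  assume "\<not> ?thesis"
  then have "ereal C < Liminf F (\<lambda>z. ereal (f z))" by simp
  then have "\<forall>\<^sub>F z in F. C < f z" by (auto dest: less_LiminfD)
  then have "\<forall>\<^sub>F y in G. C < f (\<gamma> y)"
    using assms(1) by (rule eventually_compose_filterlim)
  with assms(3) have "\<forall>\<^sub>F y in G. False" by eventually_elim simp
  then show False using assms(2) by simp
qed

text \<open>With \<open>u = \<beta>wg\<close> the function is \<open>h = \<xi> + \<beta>w/(1 - u)\<close>, and \<open>u \<rightarrow> 0\<close> nontangentially. The
  limit, the expansion with error \<open>\<beta>wu/(1 - u)\<close>, and the bound of order \<open>y\<close> for \<open>Im h\<close> on the
  vertical segment can be read off from this form.\<close>

lemma boundary_data_of_parameter:
  assumes x: "x \<in> \<real> \<times> uhp" and \<beta>: "\<beta> > 0" and g: "g \<in> Pick2"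
    and lim: "((\<lambda>y::real. of_real y * g (above x y)) \<longlongrightarrow> 0) (at_right 0)"
    and hg: "\<And>z. z \<in> uhp2 \<Longrightarrow> h z = of_real \<xi> + 1 / (1 / (of_real \<beta> * (fst z - fst x)) - g z)"
  shows "h \<in> Pick2" "B_point h x" "has_nt_limit h x (of_real \<xi>)"
    "has_angular_gradient h x (of_real \<beta>, 0)"
proof -
  have x0: "Im (fst x) = 0" using x by (auto simp: complex_is_Real_iff)
  define G where "G z = g z + - (1 / (of_real \<beta> * (fst z - fst x)))" for z
  have Ghol: "G holomorphic2_on uhp2"
    unfolding G_def
    by (rule holomorphic2_on_add[OF _ holomorphic2_on_neg_inverse_linear[OF x \<beta>]])
      (use g in \<open>simp add: Pick2_def\<close>)
  have GIm: "Im (G z) > 0" if z: "z \<in> uhp2" for z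
  proof -
    have "norm (fst z - fst x) > 0" using z x0 by (auto simp: uhp_def)
    then have "Im (fst z) / (\<beta> * (norm (fst z - fst x))\<^sup>2) > 0" using z \<beta> by (auto simp: uhp_def)
    moreover have "Im (g z) \<ge> 0" using g z unfolding Pick2_def by blast
    ultimately show ?thesis unfolding G_def plus_complex.sel Im_neg_inverse_linear[OF x \<beta>] by simp
  qed
  have hG: "h z = of_real \<xi> + (-1) / (G z - 0)" if "z \<in> uhp2" for z
  proof -
    have "1 / (of_real \<beta> * (fst z - fst x)) - g z = - G z" by (simp add: G_def)
    then show ?thesis by (simp add: hg[OF that])
  qed
  have "h holomorphic2_on uhp2"
    by (rule holomorphic2_on_cong[OF holomorphic2_on_compose[OF Ghol has_field_derivative_inverse_shift] hG])
      (use GIm in force)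
  moreover have "Im (h z) \<ge> 0" if "z \<in> uhp2" for z
    using Im_neg_inverse[of "G z"] GIm[OF that] by (simp add: hG[OF that])
  ultimately show hP: "h \<in> Pick2" by (simp add: Pick2_def)

  define u where "u z = of_real \<beta> * ((fst z - fst x) * g z)" for z
  have un: "1 - u z \<noteq> 0" if z: "z \<in> uhp2" for z
  proof -
    have "fst z \<noteq> fst x" using z x0 by (auto simp: uhp_def)
    then have "1 - u z = - G z * (of_real \<beta> * (fst z - fst x))"
      using \<beta> by (simp add: u_def G_def field_simps)
    then show ?thesis using GIm[OF z] \<open>fst z \<noteq> fst x\<close> \<beta> by auto
  qed
  have hu: "h z = of_real \<xi> + of_real \<beta> * (fst z - fst x) / (1 - u z)" if z: "z \<in> uhp2" for z
  proof -
    have "fst z \<noteq> fst x" using z x0 by (auto simp: uhp_def)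
    then have "1 / (of_real \<beta> * (fst z - fst x)) - g z = (1 - u z) / (of_real \<beta> * (fst z - fst x))"
      using \<beta> by (simp add: u_def field_simps)
    then show ?thesis by (simp add: hg[OF z])
  qed

  have u0: "(u \<longlongrightarrow> 0) (at x within S)" if S: "nt_approach S x" for S
    using tendsto_mult_left[OF nt_tendsto_of_vertical[OF x g S lim], of "of_real \<beta>"]
    by (simp add: u_def[abs_def])
  have inS: "\<forall>\<^sub>F z in at x within S. z \<in> uhp2 \<and> z \<noteq> x" if "nt_approach S x" for S
    using that by (auto simp: nt_approach_def eventually_at_filter intro!: always_eventually)
  show nt: "has_nt_limit h x (of_real \<xi>)"
    unfolding has_nt_limit_def
  proof (intro allI impI)
    fix S assume S: "nt_approach S x"
    have "((\<lambda>z. of_real \<xi> + of_real \<beta> * (fst z - fst x) / (1 - u z)) \<longlongrightarrow>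
        of_real \<xi> + of_real \<beta> * (fst x - fst x) / (1 - 0)) (at x within S)"
      by (intro tendsto_intros u0 S) auto
    then have "(h \<longlongrightarrow> of_real \<xi> + of_real \<beta> * (fst x - fst x) / (1 - 0)) (at x within S)"
      by (rule Lim_transform_eventually) (use inS[OF S] in eventually_elim, use hu in auto)
    then show "(h \<longlongrightarrow> of_real \<xi>) (at x within S)" by simp
  qed

  have expansion: "first_order_expansion h x S \<xi> (of_real \<beta>, 0)" if S: "nt_approach S x" for S
    unfolding first_order_expansion_def
  proof (rule smalloI_tendsto)
    have lim0: "((\<lambda>z. norm (of_real \<beta> * (u z / (1 - u z)))) \<longlongrightarrow> norm (of_real \<beta> * (0 / (1 - 0 :: complex)))) (at x within S)"
      by (intro tendsto_intros u0 S) auto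
    have m0: "maxnorm (z - x) > 0" if "z \<noteq> x" for z
      using that by (auto simp: maxnorm_def less_max_iff_disj prod_eq_iff)
    show "\<forall>\<^sub>F z in at x within S. complex_of_real (maxnorm (z - x)) \<noteq> 0"
      using inS[OF S] by eventually_elim (use m0 in force)
    have "\<forall>\<^sub>F z in at x within S. norm ((h z - (of_real \<xi> + fst (of_real \<beta>, 0) * (fst z - fst x)
         + snd (of_real \<beta>, 0) * (snd z - snd x))) / of_real (maxnorm (z - x)))
       \<le> norm (of_real \<beta> * (u z / (1 - u z)))"
      using inS[OF S]
    proof eventually_elim
      case (elim z)
      have "h z - (of_real \<xi> + of_real \<beta> * (fst z - fst x)) = (of_real \<beta> * (u z / (1 - u z))) * (fst z - fst x)"
        using hu[of z] un[of z] elim by (simp add: field_simps)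
      moreover have "norm (fst z - fst x) / maxnorm (z - x) \<le> 1"
        using m0[of z] elim by (simp add: divide_le_eq) (simp add: maxnorm_def)
      then have "norm (of_real \<beta> * (u z / (1 - u z))) * (norm (fst z - fst x) / maxnorm (z - x))
          \<le> norm (of_real \<beta> * (u z / (1 - u z)))"
        by (intro mult_left_le) auto
      ultimately show ?case using m0[of z] elim by (simp add: norm_mult norm_divide)
    qed
    then show "((\<lambda>z. (h z - (of_real \<xi> + fst (of_real \<beta>, 0) * (fst z - fst x)
         + snd (of_real \<beta>, 0) * (snd z - snd x))) / of_real (maxnorm (z - x))) \<longlongrightarrow> 0) (at x within S)"
      by (rule Lim_null_comparison) (use lim0 in simp)
  qed
  show "has_angular_gradient h x (of_real \<beta>, 0)"
    unfolding has_angular_gradient_def C_point_def using expansion in_frontier[OF x] by blast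

  have seg: "nt_approach (vertical_segment x) x" by (rule nt_approach_vertical_segment[OF x])
  have "((\<lambda>y. u (above x y)) \<longlongrightarrow> 0) (at_right 0)"
    by (rule filterlim_compose[OF u0[OF seg] filterlim_above_segment[OF x]])
  then have "((\<lambda>y. norm (of_real \<beta> / (1 - u (above x y)))) \<longlongrightarrow> norm (of_real \<beta> / (1 - 0 :: complex))) (at_right 0)"
    by (intro tendsto_intros) auto
  then have small: "\<forall>\<^sub>F y in at_right 0. norm (of_real \<beta> / (1 - u (above x y))) < \<beta> + 1"
    by (rule order_tendstoD) (use \<beta> in simp)
  have pos: "\<forall>\<^sub>F y in at_right (0::real). y > 0" by (rule eventually_at_right_less)
  have quot: "Im (h (above x y)) \<le> (\<beta> + 1) * y"
    if "norm (of_real \<beta> / (1 - u (above x y))) < \<beta> + 1" "y > 0" for y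
  proof -
    have "h (above x y) - of_real \<xi> = of_real \<beta> / (1 - u (above x y)) * (\<i> * of_real y)"
      using hu[OF above_in_uhp2[OF x that(2)]] by simp
    then have "norm (h (above x y) - of_real \<xi>) = norm (of_real \<beta> / (1 - u (above x y))) * y"
      using that by (metis abs_of_pos norm_ii norm_mult norm_of_real mult_1)
    also have "\<dots> \<le> (\<beta> + 1) * y" using that by (intro mult_right_mono) auto
    finally show ?thesis using abs_Im_le_cmod[of "h (above x y) - of_real \<xi>"] by simp
  qed
  have b: "Im (snd x) > 0" using x by (auto simp: uhp_def)
  have "Liminf (at x within uhp2) (\<lambda>z. ereal (Im (h z) / Im (fst z))) < \<infinity>"
  proof (rule Liminf_less_infinity[OF filterlim_above_uhp2[OF x]])
    show "\<forall>\<^sub>F y in at_right 0. Im (h (above x y)) / Im (fst (above x y)) \<le> \<beta> + 1"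
      using small pos by eventually_elim (use quot x0 in \<open>simp add: divide_le_eq\<close>)
  qed simp
  moreover have "Liminf (at x within uhp2) (\<lambda>z. ereal (Im (h z) / Im (snd z))) < \<infinity>"
  proof (rule Liminf_less_infinity[OF filterlim_above_uhp2[OF x]])
    have "\<forall>\<^sub>F y in at_right 0. y < Im (snd x)"
      using eventually_at_right_real[OF b] by eventually_elim simp
    with small pos
    show "\<forall>\<^sub>F y in at_right 0. Im (h (above x y)) / Im (snd (above x y)) \<le> \<beta> + 1"
    proof eventually_elim
      case (elim y)
      have "(\<beta> + 1) * y \<le> (\<beta> + 1) * Im (snd x)" using elim \<beta> by (intro mult_left_mono) auto
      then show ?case using quot[of y] elim b by (simp add: divide_le_eq)
    qed
  qed simp
  ultimately show "B_point h x" unfolding B_point_def using in_frontier[OF x] by blast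
qed

section \<open>Julia's inequality, and from the function to the parameter\<close>

lemma tendsto_of_difference_quotient:
  fixes f :: "real \<Rightarrow> complex"
  assumes "((\<lambda>y. (f y - a) / of_real y) \<longlongrightarrow> d) (at_right 0)"
  shows "(f \<longlongrightarrow> a) (at_right 0)"
proof -
  have pos: "\<forall>\<^sub>F y in at_right (0::real). y > 0" by (rule eventually_at_right_less)
  have "((\<lambda>y. (f y - a) / of_real y * of_real y + a) \<longlongrightarrow> d * of_real 0 + a) (at_right 0)"
    by (intro tendsto_intros assms)
  then have "(f \<longlongrightarrow> d * of_real 0 + a) (at_right 0)"
    by (rule Lim_transform_eventually) (use pos in eventually_elim, auto)
  then show ?thesis by simp
qed

text \<open>In terms of imaginary parts, Schwarz-Pick for \<open>z\<close> and \<open>(a + iy, b)\<close> with the distance of the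
  first coordinates as the larger one reads
  \<open>|h(z) - h(a + iy, b)|\<^sup>2 Im z\<^sup>1 \<le> |z\<^sup>1 - a - iy|\<^sup>2 Im h(z) Im h(a + iy, b) / y\<close>. As \<open>y \<rightarrow> 0\<close> the last
  quotient tends to \<open>\<beta>\<close>.\<close>

lemma Julia2:
  assumes x: "x \<in> \<real> \<times> uhp" and h: "h \<in> Pick2" and z: "z \<in> uhp2"
    and lim: "((\<lambda>y. (h (above x y) - of_real \<xi>) / of_real y) \<longlongrightarrow> \<i> * of_real \<beta>) (at_right 0)"
  shows "Im (fst z) * (norm (h z - of_real \<xi>))\<^sup>2 \<le> \<beta> * Im (h z) * (norm (fst z - fst x))\<^sup>2"
proof -
  have x0: "Im (fst x) = 0" "snd x \<in> uhp" using x by (auto simp: complex_is_Real_iff)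
  have zx: "fst z \<noteq> fst x" using z x0 by (auto simp: uhp_def)
  have pos: "\<forall>\<^sub>F y in at_right (0::real). y > 0" by (rule eventually_at_right_less)
  have val: "((\<lambda>y. h (above x y)) \<longlongrightarrow> of_real \<xi>) (at_right 0)"
    by (rule tendsto_of_difference_quotient[OF lim])
  have slope: "((\<lambda>y. Im (h (above x y)) / y) \<longlongrightarrow> \<beta>) (at_right 0)"
    using tendsto_Im[OF lim] by simp
  have "((\<lambda>y. pseudo_dist (fst z) (fst (above x y))) \<longlongrightarrow>
      norm (fst z - (fst x + \<i> * of_real 0)) / norm (fst z - cnj (fst x + \<i> * of_real 0))) (at_right 0)"
    unfolding pseudo_dist_def fst_conv using zx x0
    by (intro tendsto_intros) (auto simp: complex_eq_iff)
  moreover have "cnj (fst x) = fst x" using x0 by (simp add: complex_eq_iff)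
  ultimately have "((\<lambda>y. pseudo_dist (fst z) (fst (above x y))) \<longlongrightarrow> 1) (at_right 0)"
    using zx by simp
  \<comment> \<open>Near the boundary the first coordinate dominates, whatever the second coordinate of \<open>z\<close> is.\<close>
  then have far: "\<forall>\<^sub>F y in at_right 0. pseudo_dist (fst z) (fst (above x y)) > pseudo_dist (snd z) (snd x)"
    by (rule order_tendstoD) (use pseudo_dist_less_1 z x0 in auto)
  have "\<forall>\<^sub>F y in at_right 0. Im (fst z) * (norm (h z - h (above x y)))\<^sup>2
      \<le> (norm (fst z - fst (above x y)))\<^sup>2 * Im (h z) * (Im (h (above x y)) / y)"
    using far pos
  proof eventually_elim
    case (elim y)
    let ?p = "above x y" let ?r = "pseudo_dist (fst z) (fst ?p)"
    have p: "?p \<in> uhp2" by (rule above_in_uhp2[OF x]) fact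
    have "norm (h z - h ?p) \<le> ?r * norm (h z - cnj (h ?p))"
      by (rule Schwarz_Pick2[OF h z p]) (use elim pseudo_dist_less_1[of "fst z" "fst ?p"] z p in auto)
    then have "(norm (h z - h ?p))\<^sup>2 \<le> (?r * norm (h z - cnj (h ?p)))\<^sup>2"
      by (intro power_mono) auto
    moreover have "fst z - cnj (fst ?p) \<noteq> 0" using neq_cnj[of "fst z" "fst ?p"] z p by (auto simp: uhp_def)
    ultimately have "(norm (h z - h ?p))\<^sup>2 * (norm (fst z - cnj (fst ?p)))\<^sup>2
        \<le> (norm (fst z - fst ?p))\<^sup>2 * (norm (h z - cnj (h ?p)))\<^sup>2"
      unfolding pseudo_dist_def by (simp add: power_mult_distrib power_divide field_simps del: fst_conv)
    then have "(norm (h z - h ?p))\<^sup>2 * (Im (fst z) * y) \<le> (norm (fst z - fst ?p))\<^sup>2 * (Im (h z) * Im (h ?p))"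
      unfolding norm_diff_cnj_sq using x0 by (simp add: algebra_simps)
    then show ?case using elim by (simp add: field_simps)
  qed
  moreover have "((\<lambda>y. Im (fst z) * (norm (h z - h (above x y)))\<^sup>2) \<longlongrightarrow>
      Im (fst z) * (norm (h z - of_real \<xi>))\<^sup>2) (at_right 0)"
    by (intro tendsto_intros val)
  moreover have "((\<lambda>y. (norm (fst z - fst (above x y)))\<^sup>2 * Im (h z) * (Im (h (above x y)) / y)) \<longlongrightarrow>
      (norm (fst z - (fst x + \<i> * of_real 0)))\<^sup>2 * Im (h z) * \<beta>) (at_right 0)"
    unfolding fst_conv by (intro tendsto_intros slope)
  ultimately have "Im (fst z) * (norm (h z - of_real \<xi>))\<^sup>2
      \<le> (norm (fst z - (fst x + \<i> * of_real 0)))\<^sup>2 * Im (h z) * \<beta>"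
    by (intro tendsto_le[of "at_right (0::real)"]) auto
  then show ?thesis by (simp add: algebra_simps)
qed

text \<open>If \<open>h(z)\<close> is real, both sides of Schwarz-Pick contain the same norm, with a factor less
  than 1 on the right. This is the strong maximum principle for \<open>Im h\<close>.\<close>

lemma Pick2_real_value_const:
  assumes h: "h \<in> Pick2" and z: "z \<in> uhp2" and p: "p \<in> uhp2" and hz: "h z = of_real \<xi>"
  shows "h p = of_real \<xi>"
proof -
  define r where "r = max (pseudo_dist (fst z) (fst p)) (pseudo_dist (snd z) (snd p))"
  have r: "r < 1" using z p by (auto simp: r_def intro!: pseudo_dist_less_1)
  have "norm (of_real \<xi> - h p) \<le> r * norm (of_real \<xi> - cnj (h p))"
    using Schwarz_Pick2[OF h z p _ _ r] by (simp add: r_def hz)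
  also have "norm (of_real \<xi> - cnj (h p)) = norm (of_real \<xi> - h p)"
    by (metis complex_cnj_complex_of_real complex_cnj_diff complex_mod_cnj)
  finally have "(1 - r) * norm (of_real \<xi> - h p) \<le> 0" by (simp add: algebra_simps)
  then show ?thesis using r by (simp add: mult_le_0_iff)
qed

text \<open>The angular gradient comes with a constant term \<open>\<xi>'\<close> of its own. On the vertical segment
  the expansion forces \<open>h \<rightarrow> \<xi>'\<close>, so \<open>\<xi>' = \<xi>\<close>.\<close>

lemma vertical_slope:
  assumes x: "x \<in> \<real> \<times> uhp"
    and nt: "has_nt_limit h x (of_real \<xi>)" and gr: "has_angular_gradient h x (of_real \<beta>, 0)"
  shows "((\<lambda>y. (h (above x y) - of_real \<xi>) / of_real y) \<longlongrightarrow> \<i> * of_real \<beta>) (at_right 0)"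
proof -
  have seg: "nt_approach (vertical_segment x) x" by (rule nt_approach_vertical_segment[OF x])
  note path = filterlim_above_segment[OF x]
  have pos: "\<forall>\<^sub>F y in at_right (0::real). y > 0" by (rule eventually_at_right_less)
  obtain \<xi>' where "first_order_expansion h x (vertical_segment x) \<xi>' (of_real \<beta>, 0)"
    using gr seg unfolding has_angular_gradient_def by blast
  then have "((\<lambda>z. (h z - (of_real \<xi>' + of_real \<beta> * (fst z - fst x))) / of_real (maxnorm (z - x)))
      \<longlongrightarrow> 0) (at x within vertical_segment x)"
    unfolding first_order_expansion_def by (auto dest!: smalloD_tendsto)
  from filterlim_compose[OF this path]
  have lim0: "((\<lambda>y. (h (above x y) - (of_real \<xi>' + of_real \<beta> * (\<i> * of_real y))) / of_real \<bar>y\<bar>) \<longlongrightarrow> 0) (at_right 0)"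
    by (simp add: maxnorm_def norm_mult)
  have "((\<lambda>y. (h (above x y) - (of_real \<xi>' + of_real \<beta> * (\<i> * of_real y))) / of_real \<bar>y\<bar> + \<i> * of_real \<beta>)
      \<longlongrightarrow> 0 + \<i> * of_real \<beta>) (at_right 0)"
    by (intro tendsto_intros lim0)
  then have "((\<lambda>y. (h (above x y) - of_real \<xi>') / of_real y) \<longlongrightarrow> 0 + \<i> * of_real \<beta>) (at_right 0)"
    by (rule Lim_transform_eventually) (use pos in eventually_elim, simp add: field_simps)
  then have slope': "((\<lambda>y. (h (above x y) - of_real \<xi>') / of_real y) \<longlongrightarrow> \<i> * of_real \<beta>) (at_right 0)"
    by simp
  have "((\<lambda>y. h (above x y)) \<longlongrightarrow> of_real \<xi>') (at_right 0)"
    by (rule tendsto_of_difference_quotient[OF slope'])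
  moreover have "((\<lambda>y. h (above x y)) \<longlongrightarrow> of_real \<xi>) (at_right 0)"
    using nt seg unfolding has_nt_limit_def by (blast intro: filterlim_compose[OF _ path])
  ultimately have "(of_real \<xi>' :: complex) = of_real \<xi>"
    using tendsto_unique[of "at_right (0::real)"] by fastforce
  then show ?thesis using slope' by simp
qed

text \<open>Solving the formula for \<open>g\<close> requires \<open>h \<noteq> \<xi>\<close> everywhere. A single real value would make \<open>h\<close>
  constant, against the slope \<open>\<beta> \<noteq> 0\<close>. Given that, Julia's inequality divided by
  \<open>\<beta> |h - \<xi>|\<^sup>2 |w|\<^sup>2\<close> says that \<open>Im g \<ge> 0\<close>.\<close>

lemma Pick2_parameter_of_slope:
  assumes x: "x \<in> \<real> \<times> uhp" and \<beta>: "\<beta> > 0" and h: "h \<in> Pick2"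
    and lim: "((\<lambda>y. (h (above x y) - of_real \<xi>) / of_real y) \<longlongrightarrow> \<i> * of_real \<beta>) (at_right 0)"
  defines "g \<equiv> \<lambda>z. 1 / (of_real \<beta> * (fst z - fst x)) - 1 / (h z - of_real \<xi>)"
  shows "g \<in> Pick2"
    and "((\<lambda>y::real. of_real y * g (above x y)) \<longlongrightarrow> 0) (at_right 0)"
    and "z \<in> uhp2 \<Longrightarrow> h z = of_real \<xi> + 1 / (1 / (of_real \<beta> * (fst z - fst x)) - g z)"
proof -
  have pos: "\<forall>\<^sub>F y in at_right (0::real). y > 0" by (rule eventually_at_right_less)
  have x0: "Im (fst x) = 0" using x by (auto simp: complex_is_Real_iff)
  have ne: "h z \<noteq> of_real \<xi>" if z: "z \<in> uhp2" for z
  proof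
    assume "h z = of_real \<xi>"
    then have "\<forall>\<^sub>F y in at_right 0. (h (above x y) - of_real \<xi>) / of_real y = 0"
      using Pick2_real_value_const[OF h z above_in_uhp2[OF x]] pos
      by (auto elim!: eventually_mono)
    then have "((\<lambda>y. (h (above x y) - of_real \<xi>) / of_real y) \<longlongrightarrow> 0) (at_right 0)"
      by (rule tendsto_eventually)
    then have "\<i> * of_real \<beta> = 0" using tendsto_unique[OF _ lim] by simp
    then show False using \<beta> by simp
  qed
  have "(\<lambda>z. - (- (1 / (of_real \<beta> * (fst z - fst x))))) holomorphic2_on uhp2"
    by (rule holomorphic2_on_compose[OF holomorphic2_on_neg_inverse_linear[OF x \<beta>], of uminus])
      (auto intro!: exI[of _ "-1"] derivative_eq_intros)
  moreover have "h holomorphic2_on uhp2" using h by (simp add: Pick2_def)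
  then have "(\<lambda>z. 0 + (-1) / (h z - of_real \<xi>)) holomorphic2_on uhp2"
    by (rule holomorphic2_on_compose) (intro has_field_derivative_inverse_shift ne)
  ultimately have "(\<lambda>z. - (- (1 / (of_real \<beta> * (fst z - fst x)))) + (0 + (-1) / (h z - of_real \<xi>))) holomorphic2_on uhp2"
    by (rule holomorphic2_on_add)
  then have hol: "g holomorphic2_on uhp2"
    by (rule holomorphic2_on_cong) (simp add: g_def)
  have "Im (g z) \<ge> 0" if z: "z \<in> uhp2" for z
  proof -
    have zx: "norm (fst z - fst x) > 0" using z x0 by (auto simp: uhp_def)
    have hn: "norm (h z - of_real \<xi>) > 0" using ne[OF z] by simp
    have "Im (fst z) / (\<beta> * (norm (fst z - fst x))\<^sup>2) \<le> Im (h z) / (norm (h z - of_real \<xi>))\<^sup>2"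
      using Julia2[OF x h z lim] zx hn \<beta> by (simp add: divide_le_eq le_divide_eq) (simp add: field_simps)
    moreover have "Im (g z) = Im (- (1 / (h z - of_real \<xi>))) - Im (- (1 / (of_real \<beta> * (fst z - fst x))))"
      by (simp add: g_def)
    then have "Im (g z) = Im (h z) / (norm (h z - of_real \<xi>))\<^sup>2 - Im (fst z) / (\<beta> * (norm (fst z - fst x))\<^sup>2)"
      unfolding Im_neg_inverse_linear[OF x \<beta>] unfolding Im_neg_inverse by simp
    ultimately show ?thesis by simp
  qed
  then show "g \<in> Pick2" using hol by (simp add: Pick2_def)
  have "((\<lambda>y. 1 / (\<i> * of_real \<beta>) - 1 / ((h (above x y) - of_real \<xi>) / of_real y)) \<longlongrightarrow>
      1 / (\<i> * of_real \<beta>) - 1 / (\<i> * of_real \<beta>)) (at_right 0)"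
    using \<beta> by (intro tendsto_intros lim) auto
  then have "((\<lambda>y. of_real y * g (above x y)) \<longlongrightarrow> 1 / (\<i> * of_real \<beta>) - 1 / (\<i> * of_real \<beta>)) (at_right 0)"
  proof (rule Lim_transform_eventually)
    show "\<forall>\<^sub>F y in at_right 0. 1 / (\<i> * of_real \<beta>) - 1 / ((h (above x y) - of_real \<xi>) / of_real y) =
        of_real y * g (above x y)"
      using pos
    proof eventually_elim
      case (elim y)
      have "of_real y * g (above x y) =
          of_real y / (of_real \<beta> * (\<i> * of_real y)) - of_real y / (h (above x y) - of_real \<xi>)"
        by (simp add: g_def algebra_simps)
      moreover have "of_real y / (of_real \<beta> * (\<i> * of_real y)) = 1 / (\<i> * of_real \<beta>)"
        using elim by (simp add: field_simps)
      ultimately show ?case by simp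
    qed
  qed
  then show "((\<lambda>y::real. of_real y * g (above x y)) \<longlongrightarrow> 0) (at_right 0)" by simp
  show "h z = of_real \<xi> + 1 / (1 / (of_real \<beta> * (fst z - fst x)) - g z)" if "z \<in> uhp2"
    using ne[OF that] by (simp add: g_def)
qed

section \<open>The parametrization\<close>

theorem theorem6p1:
  fixes x :: "complex \<times> complex" and \<xi> \<beta> :: real
    and h :: "complex \<times> complex \<Rightarrow> complex"
  assumes "x \<in> \<real> \<times> uhp" and "\<beta> > 0"
  shows "(h \<in> Pick2 \<and> B_point h x \<and> has_nt_limit h x (of_real \<xi>)
            \<and> has_angular_gradient h x (of_real \<beta>, 0))
    \<longleftrightarrow> (\<exists>g\<in>Pick2.
          ((\<lambda>y::real. of_real y * g (fst x + \<i> * of_real y, snd x)) \<longlongrightarrow> 0) (at_right 0) \<and>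
          (\<forall>z\<in>uhp2. h z = of_real \<xi> + 1 / (1 / (of_real \<beta> * (fst z - fst x)) - g z)))"
proof
  assume h: "h \<in> Pick2 \<and> B_point h x \<and> has_nt_limit h x (of_real \<xi>)
            \<and> has_angular_gradient h x (of_real \<beta>, 0)"
  then have "((\<lambda>y. (h (above x y) - of_real \<xi>) / of_real y) \<longlongrightarrow> \<i> * of_real \<beta>) (at_right 0)"
    using vertical_slope[OF assms(1)] by blast
  note * = Pick2_parameter_of_slope[OF assms conjunct1[OF h] this]
  show "\<exists>g\<in>Pick2.
          ((\<lambda>y::real. of_real y * g (above x y)) \<longlongrightarrow> 0) (at_right 0) \<and>
          (\<forall>z\<in>uhp2. h z = of_real \<xi> + 1 / (1 / (of_real \<beta> * (fst z - fst x)) - g z))"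
    using * by (intro bexI[OF _ *(1)]) auto
next
  assume "\<exists>g\<in>Pick2.
          ((\<lambda>y::real. of_real y * g (above x y)) \<longlongrightarrow> 0) (at_right 0) \<and>
          (\<forall>z\<in>uhp2. h z = of_real \<xi> + 1 / (1 / (of_real \<beta> * (fst z - fst x)) - g z))"
  then show "h \<in> Pick2 \<and> B_point h x \<and> has_nt_limit h x (of_real \<xi>)
            \<and> has_angular_gradient h x (of_real \<beta>, 0)"
    using boundary_data_of_parameter[OF assms] by blast
qed

end
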